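(* Let $\omega:\mathbb{R}_+\to\mathbb{R}_+$ be an $A_2$-Muckenhoupt weight. Then $\omega\notin L^1(\mathbb{R}_+)$.
   Context: $\mathbb{R}_+:=(0,+\infty)$. A function $\omega:\mathbb{R}_+\to\mathbb{R}_+$ is an $A_2$-Muckenhoupt weight if it is locally integrable and there is $C>0$ such that $\frac1{|I|^2}\big(\int_I\omega\big)\big(\int_I\frac1\omega\big)\le C$ for all bounded intervals $I\subset\mathbb{R}_+$, where $|I|$ is the Lebesgue measure of $I$. *)

theory Defs
  imports "HOL-Analysis.Analysis"
begin

definition locally_integrable_on :: "(real \<Rightarrow> real) \<Rightarrow> real set \<Rightarrow> bool"
  where "locally_integrable_on f S \<longleftrightarrow>
    (\<forall>K. compact K \<and> K \<subseteq> S \<longrightarrow> set_integrable lebesgue K f)"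

text \<open>A function on the open half-line is represented by a function on all reals whose values
  outside the half-line are irrelevant. The integrals are taken in the extended nonnegative
  reals, so that a weight for which one of them is infinite violates the bound: local
  integrability in the open half-line gives no control of either integral near 0. The empty
  and one-point intervals are left out, since the quotient is not defined for them.\<close>

definition A2_weight :: "(real \<Rightarrow> real) \<Rightarrow> bool"
  where "A2_weight \<omega> \<longleftrightarrow>
    (\<forall>x>0. \<omega> x > 0) \<and>
    locally_integrable_on \<omega> {0<..} \<and>
    (\<exists>C::real. C > 0 \<and>
      (\<forall>I. is_interval I \<and> bounded I \<and> I \<subseteq> {0<..} \<and> 0 < emeasure lebesgue I \<longrightarrow>
        1 / (emeasure lebesgue I)\<^sup>2
          * (\<integral>\<^sup>+x\<in>I. ennreal (\<omega> x) \<partial>lebesgue)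
          * (\<integral>\<^sup>+x\<in>I. ennreal (1 / \<omega> x) \<partial>lebesgue) \<le> ennreal C))"

end

theory Submission
  imports Defs
begin

text \<open>Let \<open>c > 0\<close> be the integral of \<open>\<omega>\<close> over \<open>(0,1)\<close>. For \<open>T \<ge> 1\<close> the \<open>A\<^sub>2\<close> bound on \<open>(0,2T)\<close> shows that
  the integral of \<open>1/\<omega>\<close> over \<open>(0,2T)\<close> is at most \<open>K T\<^sup>2\<close> with \<open>K = 4C/c\<close>. Integrating
  \<open>2 \<le> K T \<omega> + 1/(K T \<omega>)\<close> over \<open>[T,2T)\<close> gives \<open>2T \<le> K T A + T\<close>, where \<open>A\<close> is the integral of \<open>\<omega>\<close>
  over \<open>[T,2T)\<close>; so \<open>A \<ge> 1/K\<close> on every dyadic interval, and the total integral is infinite.\<close>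

lemma nn_integral_weight_ge:
  fixes f :: "real \<Rightarrow> real"
  assumes f [measurable]: "f \<in> borel_measurable lebesgue"
    and pos: "\<And>x. x > 0 \<Longrightarrow> f x > 0"
    and K: "K > 0" and T: "T > 0"
    and bound: "(\<integral>\<^sup>+x\<in>{T..<2 * T}. ennreal (1 / f x) \<partial>lebesgue) \<le> ennreal (K * T\<^sup>2)"
  shows "ennreal (1 / K) \<le> (\<integral>\<^sup>+x\<in>{T..<2 * T}. ennreal (f x) \<partial>lebesgue)" (is "_ \<le> ?A")
proof (cases "?A = \<infinity>")
  case False
  then obtain a where a: "a \<ge> 0" "?A = ennreal a"
    by (cases ?A) auto
  define J where "J = {T..<2 * T}"
  have J [measurable]: "J \<in> sets lebesgue"
    by (simp add: J_def)
  have KT: "K * T > 0"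
    using K T by simp
  \<comment> \<open>This is 2 <= u + 1/u with u = \<open>K * T * f x\<close>. The factor
    \<open>K * T\<close> is chosen so that, by \<open>bound\<close>, the reciprocal term integrates
    to at most 1/(K T) * K T^2 = T, half of the 2T on the left. The indicators make both sides
    vanish off \<open>J\<close>, so the inequality can be integrated over the whole line.\<close>
  have pw: "ennreal 2 * indicator J x \<le> ennreal (K * T) * (ennreal (f x) * indicator J x)
      + ennreal (1 / (K * T)) * (ennreal (1 / f x) * indicator J x)" for x
  proof (cases "x \<in> J")
    case True
    define u where "u = K * T * f x"
    have fx: "f x > 0"
      using True T by (intro pos) (auto simp: J_def)
    then have u: "u > 0"
      using KT by (simp add: u_def)
    have "2 * u \<le> u * u + 1"
      using zero_le_power2[of "u - 1"] by (simp add: power2_eq_square algebra_simps)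
    then have "2 \<le> u + 1 / u"
      using u by (simp add: field_simps)
    then have "2 \<le> K * T * f x + 1 / (K * T) * (1 / f x)"
      by (simp add: u_def)
    then have "ennreal 2 \<le> ennreal (K * T * f x + 1 / (K * T) * (1 / f x))"
      by (rule ennreal_leI)
    also have "\<dots> = ennreal (K * T) * ennreal (f x) + ennreal (1 / (K * T)) * ennreal (1 / f x)"
      using KT fx by (simp only: ennreal_plus ennreal_mult' mult_nonneg_nonneg divide_nonneg_nonneg
          zero_le_one less_imp_le)
    finally show ?thesis
      using True by simp
  qed simp
  have "ennreal (2 * T) = (\<integral>\<^sup>+x. ennreal 2 * indicator J x \<partial>lebesgue)"
    using T by (simp add: nn_integral_cmult_indicator J_def ennreal_mult')
  also have "\<dots> \<le> (\<integral>\<^sup>+x. ennreal (K * T) * (ennreal (f x) * indicator J x)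
      + ennreal (1 / (K * T)) * (ennreal (1 / f x) * indicator J x) \<partial>lebesgue)"
    by (intro nn_integral_mono pw)
  also have "\<dots> = ennreal (K * T) * (\<integral>\<^sup>+x\<in>J. ennreal (f x) \<partial>lebesgue)
      + ennreal (1 / (K * T)) * (\<integral>\<^sup>+x\<in>J. ennreal (1 / f x) \<partial>lebesgue)"
    by (subst nn_integral_add) (simp_all add: nn_integral_cmult)
  also have "\<dots> \<le> ennreal (K * T) * ennreal a + ennreal (1 / (K * T)) * ennreal (K * T\<^sup>2)"
    using a(2) bound by (intro add_mono mult_left_mono) (simp_all add: J_def)
  also have "\<dots> = ennreal (K * T * a + T)"
    using KT K T a(1)
    by (simp add: ennreal_mult'[symmetric] ennreal_plus[symmetric] power2_eq_square
          del: ennreal_plus)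
  finally have "2 * T \<le> K * T * a + T"
    using K T a(1) by (subst (asm) ennreal_le_iff) auto
  then have "T * 1 \<le> T * (K * a)"
    by (simp add: algebra_simps)
  then have "1 \<le> K * a"
    using T by (simp only: mult_le_cancel_left_pos)
  then show ?thesis
    using K a by (simp add: field_simps ennreal_leI)
qed simp

text \<open>The half-open blocks [2^k, 2^(k+1)) with k < n tile [1, 2^n) without overlap, and each
  contributes at least \<open>a\<close>. For n = 0 the domain is empty.\<close>

lemma nn_integral_dyadic_ge:
  fixes g :: "real \<Rightarrow> ennreal"
  assumes g [measurable]: "g \<in> borel_measurable lebesgue"
    and ge: "\<And>T. T \<ge> 1 \<Longrightarrow> ennreal a \<le> (\<integral>\<^sup>+x\<in>{T..<2 * T}. g x \<partial>lebesgue)"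
    and a: "a \<ge> 0"
  shows "ennreal (real n * a) \<le> (\<integral>\<^sup>+x\<in>{1..<2 ^ n}. g x \<partial>lebesgue)"
proof (induction n)
  case (Suc n)
  have T: "(1::real) \<le> 2 ^ n"
    by simp
  have "ennreal (real (Suc n) * a) = ennreal (real n * a) + ennreal a"
    using a by (simp add: algebra_simps flip: ennreal_plus)
  also have "\<dots> \<le> (\<integral>\<^sup>+x\<in>{1..<2 ^ n}. g x \<partial>lebesgue) + (\<integral>\<^sup>+x\<in>{2 ^ n..<2 * 2 ^ n}. g x \<partial>lebesgue)"
    by (intro add_mono Suc.IH ge T)
  also have "\<dots> = (\<integral>\<^sup>+x\<in>{1..<2 ^ n} \<union> {2 ^ n..<2 * 2 ^ n}. g x \<partial>lebesgue)"
    by (rule nn_integral_disjoint_pair[symmetric]) auto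
  also have "{1..<2 ^ n} \<union> {2 ^ n..<2 * 2 ^ n} = {1..<(2::real) ^ Suc n}"
    using T by (subst ivl_disj_un) auto
  finally show ?case .
qed simp

theorem lemma4p5:
  fixes \<omega> :: "real \<Rightarrow> real"
  assumes "A2_weight \<omega>"
  shows "\<not> set_integrable lebesgue {0<..} \<omega>"
proof
  assume int: "set_integrable lebesgue {0<..} \<omega>"
  \<comment> \<open>Off the half-line \<omega> is arbitrary and may fail to be measurable there; its
    cut-off by zero is integrable on the whole line.\<close>
  define f where "f x = indicator {0<..} x * \<omega> x" for x :: real
  have f_int: "integrable lebesgue f"
    using int by (simp add: set_integrable_def f_def[abs_def])
  then have f [measurable]: "f \<in> borel_measurable lebesgue"
    by (rule borel_measurable_integrable)
  have pos: "f x > 0" if "x > 0" for x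
    using assms that by (simp add: A2_weight_def f_def)
  have nonneg: "f x \<ge> 0" for x
    using pos[of x] by (cases "x > 0") (auto simp: f_def)
  obtain C where C: "C > 0" and A2: "\<And>I. is_interval I \<Longrightarrow> bounded I \<Longrightarrow> I \<subseteq> {0<..} \<Longrightarrow>
      0 < emeasure lebesgue I \<Longrightarrow>
      1 / (emeasure lebesgue I)\<^sup>2 * (\<integral>\<^sup>+x\<in>I. ennreal (\<omega> x) \<partial>lebesgue)
          * (\<integral>\<^sup>+x\<in>I. ennreal (1 / \<omega> x) \<partial>lebesgue) \<le> ennreal C"
    using assms unfolding A2_weight_def by blast
  obtain M where M: "M \<ge> 0" "(\<integral>\<^sup>+x. ennreal (f x) \<partial>lebesgue) = ennreal M"
    using nonneg by (intro that[of "integral\<^sup>L lebesgue f"]) (simp_all add: nn_integral_eq_integral[OF f_int])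
  have le_M: "(\<integral>\<^sup>+x\<in>S. ennreal (f x) \<partial>lebesgue) \<le> ennreal M" for S
    unfolding M(2)[symmetric] by (intro nn_integral_mono) (auto split: split_indicator)
  \<comment> \<open>Since \<open>enn2real\<close> sends infinity to 0, \<open>c\<close> represents
    the integral only once finiteness is known. That comes from the integrability assumed for
    contradiction: local integrability on the open half-line gives no control near 0.\<close>
  define c where "c = enn2real (\<integral>\<^sup>+x\<in>{0<..<1}. ennreal (f x) \<partial>lebesgue)"
  have c_eq: "(\<integral>\<^sup>+x\<in>{0<..<1}. ennreal (f x) \<partial>lebesgue) = ennreal c"
    unfolding c_def using le_M[of "{0<..<1}"]
    by (simp add: order_le_less_trans[OF _ ennreal_less_top])
  have [measurable]: "{0<..<1::real} \<in> sets lebesgue"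
    by simp
  have "(\<lambda>x. ennreal (f x) * indicator {0<..<1} x) \<in> borel_measurable lebesgue"
    by measurable
  \<comment> \<open>The integrand is positive exactly on a set of measure 1, so its integral cannot
    vanish.\<close>
  moreover have "{x. ennreal (f x) * indicator {0<..<1} x \<noteq> 0} = {0<..<1}"
    using pos by (auto split: split_indicator simp: ennreal_eq_0_iff not_le)
  ultimately have "(\<integral>\<^sup>+x\<in>{0<..<1}. ennreal (f x) \<partial>lebesgue) \<noteq> 0"
    by (simp add: nn_integral_0_iff del: mult_eq_0_iff)
  then have c: "c > 0"
    unfolding c_eq by (simp add: ennreal_eq_0_iff not_le)
  \<comment> \<open>The 4 comes from the squared length 4 T^2 of (0, 2T).\<close>
  define K where "K = 4 * C / c"
  have K: "K > 0"
    using C c by (simp add: K_def)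
  have "ennreal (1 / K) \<le> (\<integral>\<^sup>+x\<in>{T..<2 * T}. ennreal (f x) \<partial>lebesgue)" if T: "T \<ge> 1" for T
  proof (rule nn_integral_weight_ge[OF f pos K])
    define I where "I = {0<..<2 * T}"
    define Q where "Q = (\<integral>\<^sup>+x\<in>I. ennreal (1 / f x) \<partial>lebesgue)"
    have eqs: "(\<integral>\<^sup>+x\<in>I. ennreal (\<omega> x) \<partial>lebesgue) = (\<integral>\<^sup>+x\<in>I. ennreal (f x) \<partial>lebesgue)"
      "(\<integral>\<^sup>+x\<in>I. ennreal (1 / \<omega> x) \<partial>lebesgue) = Q"
      unfolding Q_def
      by (intro nn_integral_cong; simp add: f_def I_def split: split_indicator)+
    have emI: "emeasure lebesgue I = ennreal (2 * T)"
      using T by (simp add: I_def)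
    \<comment> \<open>Here \<open>T \<ge> 1\<close> enters: it puts (0,1) inside \<open>I\<close>,
      so that \<open>c\<close> bounds the mass over \<open>I\<close> from below independently of
      \<open>T\<close>.\<close>
    have ge_c: "ennreal c \<le> (\<integral>\<^sup>+x\<in>I. ennreal (f x) \<partial>lebesgue)"
      unfolding c_eq[symmetric] I_def using T
      by (intro nn_integral_mono) (auto split: split_indicator)
    have "1 / (ennreal (2 * T))\<^sup>2 = ennreal (1 / (2 * T)\<^sup>2)"
      using T by (simp add: ennreal_power divide_ennreal flip: ennreal_1)
    then have "ennreal (1 / (2 * T)\<^sup>2) * ennreal c * Q
        \<le> 1 / (emeasure lebesgue I)\<^sup>2 * (\<integral>\<^sup>+x\<in>I. ennreal (f x) \<partial>lebesgue) * Q"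
      unfolding emI by (simp only:) (intro mult_right_mono mult_left_mono ge_c; simp)
    also have "\<dots> \<le> ennreal C"
      by (rule A2[of I, unfolded eqs]) (use T emI in \<open>auto simp: I_def is_interval_oo\<close>)
    finally have le: "ennreal (1 / (2 * T)\<^sup>2) * ennreal c * Q \<le> ennreal C" .
    \<comment> \<open>\<open>Q\<close> is not yet known to be finite. Multiplying by the explicit
      reciprocal of the positive finite factor isolates it even if it is infinite.\<close>
    have "ennreal ((2 * T)\<^sup>2 / c) * (ennreal (1 / (2 * T)\<^sup>2) * ennreal c) = 1"
      using T c by (simp add: ennreal_mult'[symmetric] field_simps)
    then have "Q = ennreal ((2 * T)\<^sup>2 / c) * (ennreal (1 / (2 * T)\<^sup>2) * ennreal c * Q)"
      by (simp only: mult.assoc[symmetric] mult_1_left)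
    also have "\<dots> \<le> ennreal ((2 * T)\<^sup>2 / c) * ennreal C"
      by (intro mult_left_mono le) simp
    also have "\<dots> = ennreal (K * T\<^sup>2)"
      using C c by (simp add: ennreal_mult'[symmetric] K_def field_simps)
    finally have "Q \<le> ennreal (K * T\<^sup>2)" .
    moreover have "(\<integral>\<^sup>+x\<in>{T..<2 * T}. ennreal (1 / f x) \<partial>lebesgue) \<le> Q"
      unfolding Q_def I_def using T
      by (intro nn_integral_mono) (auto split: split_indicator)
    ultimately show "(\<integral>\<^sup>+x\<in>{T..<2 * T}. ennreal (1 / f x) \<partial>lebesgue) \<le> ennreal (K * T\<^sup>2)"
      by simp
  qed (use T in auto)
  then have "ennreal (real n * (1 / K)) \<le> (\<integral>\<^sup>+x\<in>{1..<2 ^ n}. ennreal (f x) \<partial>lebesgue)" for n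
    using K by (intro nn_integral_dyadic_ge) auto
  then have "ennreal (real n * (1 / K)) \<le> ennreal M" for n
    using le_M order_trans by blast
  then have "real n * (1 / K) \<le> M" for n
    using M(1) by (simp add: ennreal_le_iff)
  \<comment> \<open>\<open>M\<close> does not depend on the number n of dyadic blocks, whereas the
    lower bound n/K grows without limit.\<close>
  moreover obtain n where "M * K < real n"
    using reals_Archimedean2 by blast
  ultimately show False
    using K by (auto simp: field_simps not_le[symmetric])
qed

end
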